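(* Let $\alpha\in\mathbb{R}$ and define $$\mathfrak{H}_\alpha(t)=\frac{t^{\alpha-1}}{e^{1/t}-1},\quad t\in(0,\infty).$$ Then: (1) if $\alpha\ge1$, the function $\mathfrak{H}_\alpha(t)$ is convex on $(0,\infty)$; (2) if $0\le\alpha<1$, the function $\mathfrak{H}_\alpha(t)$ has a unique inflection point on $(0,\infty)$; (3) if $\alpha<0$, the function $\mathfrak{H}_\alpha(t)$ has exactly two inflection points on $(0,\infty)$; (4) $\lim_{t\to0^+}\mathfrak{H}_\alpha(t)=0$ for every $\alpha\in\mathbb{R}$, and $$\lim_{t\to\infty}\mathfrak{H}_\alpha(t)=\begin{cases}\infty, & \alpha>0;\\ 1, & \alpha=0;\\ 0, & \alpha<0.\end{cases}$$
   Context: With $H(t)=\frac{t}{e^t-1}$ (the generating function of the Bernoulli numbers), one has $\mathfrak{H}_\alpha(t)=t^\alpha H(1/t)$. An inflection point is a point at which the function changes from convex to concave or vice versa (i.e. where the second derivative changes sign). *)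

theory Defs
  imports "HOL-Analysis.Analysis"
begin

definition frakH :: "real \<Rightarrow> real \<Rightarrow> real" where
  "frakH \<alpha> t = t powr (\<alpha> - 1) / (exp (1 / t) - 1)"

definition changes_sign_at :: "(real \<Rightarrow> real) \<Rightarrow> real \<Rightarrow> bool" where
  "changes_sign_at g x \<longleftrightarrow>
     (\<exists>e>0. (\<forall>y\<in>{x - e<..<x}. g y < 0) \<and> (\<forall>y\<in>{x<..<x + e}. g y > 0)
          \<or> (\<forall>y\<in>{x - e<..<x}. g y > 0) \<and> (\<forall>y\<in>{x<..<x + e}. g y < 0))"

text \<open>
  The first conjunct says that \<open>f\<close> is twice differentiable near \<open>x\<close>, so that
  \<open>deriv (deriv f)\<close> is the genuine second derivative there. The sign change is
  strict on each side; otherwise every point of an affine function would qualify.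
\<close>

definition inflection_point :: "(real \<Rightarrow> real) \<Rightarrow> real \<Rightarrow> bool" where
  "inflection_point f x \<longleftrightarrow>
     (\<forall>\<^sub>F y in nhds x. f differentiable at y \<and> deriv f differentiable at y)
     \<and> changes_sign_at (deriv (deriv f)) x"

lemma inflection_point_imp_convexity_change:
  assumes "inflection_point f x"
  shows "\<exists>e>0. convex_on {x - e<..<x} f \<and> concave_on {x<..<x + e} f
             \<or> concave_on {x - e<..<x} f \<and> convex_on {x<..<x + e} f"
proof -
  obtain d where d: "d > 0"
    "\<And>y. dist y x < d \<Longrightarrow> f differentiable at y \<and> deriv f differentiable at y"
    using assms unfolding inflection_point_def eventually_nhds_metric by blast
  obtain e where e: "e > 0"
    "(\<forall>y\<in>{x - e<..<x}. deriv (deriv f) y < 0) \<and> (\<forall>y\<in>{x<..<x + e}. deriv (deriv f) y > 0)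
     \<or> (\<forall>y\<in>{x - e<..<x}. deriv (deriv f) y > 0) \<and> (\<forall>y\<in>{x<..<x + e}. deriv (deriv f) y < 0)"
    using assms unfolding inflection_point_def changes_sign_at_def by blast
  define r where "r = min d e"
  have r: "r > 0" "r \<le> d" "r \<le> e" using d(1) e(1) by (auto simp: r_def)
  have D: "DERIV f y :> deriv f y" "DERIV (deriv f) y :> deriv (deriv f) y"
    if "y \<in> {x - r<..<x} \<union> {x<..<x + r}" for y
    using d(2)[of y] that r by (auto simp: dist_real_def DERIV_deriv_iff_real_differentiable)
  have cvx: "convex_on C f" if "convex C" "C \<subseteq> {x - r<..<x} \<union> {x<..<x + r}"
    "\<forall>y\<in>C. deriv (deriv f) y > 0" for C
    using f''_ge0_imp_convex[OF that(1), of f "deriv f" "deriv (deriv f)"] D that less_imp_le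
    by blast
  have ccv: "concave_on C f" if "convex C" "C \<subseteq> {x - r<..<x} \<union> {x<..<x + r}"
    "\<forall>y\<in>C. deriv (deriv f) y < 0" for C
    using f''_le0_imp_concave[OF that(1), of f "deriv f" "deriv (deriv f)"] D that less_imp_le
    by blast
  have sub: "{x - r<..<x} \<subseteq> {x - e<..<x}" "{x<..<x + r} \<subseteq> {x<..<x + e}" using r by auto
  from e(2) show ?thesis
  proof
    assume *: "(\<forall>y\<in>{x - e<..<x}. deriv (deriv f) y < 0) \<and> (\<forall>y\<in>{x<..<x + e}. deriv (deriv f) y > 0)"
    have "concave_on {x - r<..<x} f" "convex_on {x<..<x + r} f"
      by (rule ccv cvx; use * sub in auto)+
    with r(1) show ?thesis by blast
  next
    assume *: "(\<forall>y\<in>{x - e<..<x}. deriv (deriv f) y > 0) \<and> (\<forall>y\<in>{x<..<x + e}. deriv (deriv f) y < 0)"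
    have "convex_on {x - r<..<x} f" "concave_on {x<..<x + r} f"
      by (rule ccv cvx; use * sub in auto)+
    with r(1) show ?thesis by blast
  qed
qed

end

theory Submission
  imports Defs "HOL-Real_Asymp.Real_Asymp"
begin

text \<open>
  In the variable \<open>u = 1/t\<close>, the second derivative is a positive multiple of an entire function
  \<open>N(u)\<close>, a quadratic polynomial in \<open>\<alpha>\<close> whose coefficients are exponential polynomials in \<open>u\<close>.
  For \<open>n \<ge> 2\<close> its Taylor coefficients are \<open>(2 ^ n - 2) / n!\<close> times a sequence \<open>a n\<close> that is convex
  in \<open>n\<close>, so they change sign at most twice, and a Descartes rule of signs bounds the number of
  zeros of \<open>N\<close>. Since \<open>a 2 = \<alpha> (\<alpha> - 1)\<close> and \<open>a 3 - a 2 = \<alpha> - 1\<close>, there is no sign change for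
  \<open>\<alpha> \<ge> 1\<close>, and at most one for \<open>0 \<le> \<alpha> < 1\<close>. For \<open>\<alpha> < 0\<close>, \<open>N\<close> is positive at both ends but
  negative at the \<open>u\<close> where \<open>\<alpha>\<close> is the midpoint of the two roots of that quadratic.
\<close>

section \<open>Power series whose coefficients change sign once or twice\<close>

text \<open>Dividing by \<open>u ^ M\<close> at the sign change makes every term of the series nondecreasing in \<open>u\<close>.\<close>

lemma power_series_one_sign_change:
  fixes b :: "nat \<Rightarrow> real"
  assumes sums: "\<And>u. u > 0 \<Longrightarrow> (\<lambda>n. b n * u ^ n) sums f u"
    and lo: "\<And>n. n \<le> M \<Longrightarrow> b n \<le> 0" and hi: "\<And>n. n > M \<Longrightarrow> b n \<ge> 0"
    and k: "k > M" "b k \<noteq> 0" and uv: "0 < u" "u < v"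
  shows "f u * v ^ M < f v * u ^ M"
proof -
  \<comment> \<open>These are the terms of \<open>f v * u ^ M - f u * v ^ M\<close>. Both factors of
    \<open>d n\<close> are nonpositive for \<open>n < M\<close> and nonnegative for
    \<open>n > M\<close>; at \<open>n = M\<close> the bracket vanishes.\<close>
  define d where "d n = b n * (v ^ n * u ^ M - u ^ n * v ^ M)" for n
  have "(\<lambda>n. b n * v ^ n * u ^ M - b n * u ^ n * v ^ M) sums (f v * u ^ M - f u * v ^ M)"
    using sums uv by (intro sums_diff sums_mult2) auto
  then have s: "d sums (f v * u ^ M - f u * v ^ M)"
    by (simp add: d_def[abs_def] algebra_simps)
  have lt: "v ^ i * u ^ j > u ^ i * v ^ j" if "j < i" for i j
  proof -
    have "u ^ (i - j) < v ^ (i - j)"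
      using uv that by (intro power_strict_mono) auto
    then have "(u * v) ^ j * u ^ (i - j) < (u * v) ^ j * v ^ (i - j)"
      using uv by (intro mult_strict_left_mono) auto
    moreover have "x ^ i = x ^ j * x ^ (i - j)" for x :: real
      using that by (simp flip: power_add)
    ultimately show ?thesis by (simp add: power_mult_distrib mult_ac)
  qed
  have nonneg: "d n \<ge> 0" for n
  proof (cases n M rule: linorder_cases)
    case less
    with lo[of n] lt[of n M] show ?thesis
      by (auto simp: d_def mult_ac intro!: mult_nonpos_nonpos)
  next
    case greater
    with hi[of n] lt[of M n] show ?thesis by (auto simp: d_def)
  qed (simp add: d_def)
  have "d k > 0" using k hi[of k] lt[of M k] by (auto simp: d_def)
  then have "suminf d > 0" using suminf_pos2[of d k] s nonneg by (auto simp: sums_iff)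
  with s show ?thesis by (simp add: sums_iff)
qed

text \<open>Convergence on the whole line permits termwise differentiation. Multiplying by
  \<open>u\<close> restores the exponent \<open>n\<close>, so that \<open>u * f' u\<close> combines
  with multiples of \<open>f u\<close> coefficientwise.\<close>

lemma power_series_euler_operator:
  fixes b :: "nat \<Rightarrow> real"
  assumes sums: "\<And>u. (\<lambda>n. b n * u ^ n) sums f u"
  obtains f' where "\<And>u. (f has_real_derivative f' u) (at u)"
    "\<And>u. (\<lambda>n. real n * b n * u ^ n) sums (u * f' u)"
proof
  define f' where "f' u = (\<Sum>n. diffs b n * u ^ n)" for u
  have sm: "summable (\<lambda>n. b n * u ^ n)" for u using sums by (auto simp: sums_iff)
  have f: "f = (\<lambda>u. \<Sum>n. b n * u ^ n)" using sums by (auto simp: sums_iff)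
  show "(f has_real_derivative f' u) (at u)" for u
    unfolding f f'_def by (rule termdiffs_strong_converges_everywhere[OF sm])
  show "(\<lambda>n. real n * b n * u ^ n) sums (u * f' u)" for u
  proof -
    have "summable (\<lambda>n. diffs b n * u ^ n)"
      by (rule termdiff_converges_all) (rule sm)
    from sums_mult[OF diffs_equiv[OF this], of u]
    have "(\<lambda>n. u * (of_nat n * b n * u ^ (n - Suc 0))) sums (u * f' u)"
      by (simp add: f'_def)
    \<comment> \<open>The truncated exponent \<open>n - Suc 0\<close> is harmless at
      \<open>n = 0\<close>, where the factor \<open>n\<close> vanishes.\<close>
    moreover have "u * (of_nat n * b n * u ^ (n - Suc 0)) = real n * b n * u ^ n" for n
      by (cases n) auto
    ultimately show ?thesis by simp
  qed
qed

text \<open>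
  The derivative of \<open>f u / u ^ m\<close> is \<open>u ^ (-m-1)\<close> times the series with coefficients
  \<open>(n - m) * b n\<close>, in which the sign change at \<open>m\<close> has disappeared.
\<close>

lemma power_series_two_sign_changes_quasiconvex:
  fixes b :: "nat \<Rightarrow> real"
  assumes sums: "\<And>u. (\<lambda>n. b n * u ^ n) sums f u"
    and lo: "\<And>n. n < m \<Longrightarrow> b n \<ge> 0" and mid: "\<And>n. m \<le> n \<Longrightarrow> n \<le> M \<Longrightarrow> b n \<le> 0"
    and hi: "\<And>n. n > M \<Longrightarrow> b n \<ge> 0" and "m \<le> M" and k: "k > M" "b k \<noteq> 0"
    and xyz: "0 < x" "x < y" "y < z"
    and le: "f x / x ^ m \<le> f y / y ^ m"
  shows "f y / y ^ m < f z / z ^ m"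
proof (rule ccontr)
  assume ge: "\<not> ?thesis"
  obtain f' where f': "\<And>u. (f has_real_derivative f' u) (at u)"
    "\<And>u. (\<lambda>n. real n * b n * u ^ n) sums (u * f' u)"
    using power_series_euler_operator[OF sums] by blast
  define w where "w u = u * f' u - m * f u" for u
  have w_sums: "(\<lambda>n. ((real n - real m) * b n) * u ^ n) sums w u" for u
    using sums_diff[OF f'(2)[of u] sums_mult[OF sums[of u], of "real m"]]
    by (simp add: w_def algebra_simps)
  have D: "((\<lambda>u. f u / u ^ m) has_real_derivative w u / u ^ Suc m) (at u)" if "u > 0" for u
  proof -
    have "((\<lambda>u. f u / u ^ m) has_real_derivative
        (f' u * u ^ m - f u * (real m * u ^ (m - 1))) / (u ^ m * u ^ m)) (at u)"
      using that by (auto intro!: derivative_eq_intros f'(1))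
    also have "(f' u * u ^ m - f u * (real m * u ^ (m - 1))) / (u ^ m * u ^ m) = w u / u ^ Suc m"
      using that by (cases m) (simp_all add: w_def field_simps)
    finally show ?thesis .
  qed
  \<comment> \<open>Since the quotient does not fall from \<open>x\<close> to \<open>y\<close> and,
    by \<open>ge\<close>, does not rise from \<open>y\<close> to \<open>z\<close>, the mean value
    theorem yields \<open>p < q\<close> with \<open>w p \<ge> 0 \<ge> w q\<close>.\<close>
  obtain p where p: "x < p" "p < y" "f y / y ^ m - f x / x ^ m = (y - x) * (w p / p ^ Suc m)"
    using MVT2[OF xyz(2) D] xyz by auto
  obtain q where q: "y < q" "q < z" "f z / z ^ m - f y / y ^ m = (z - y) * (w q / q ^ Suc m)"
    using MVT2[OF xyz(3) D] xyz by auto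
  have nonneg: "v \<ge> 0" if "c * v \<ge> 0" "c > 0" for c v :: real
    using that by (simp add: zero_le_mult_iff)
  have nonpos: "v \<le> 0" if "c * v \<le> 0" "c > 0" for c v :: real
    using that by (simp add: mult_le_0_iff)
  have *: "(y - x) * (w p / p ^ Suc m) \<ge> 0" using p(3) le by linarith
  have "w p / p ^ Suc m \<ge> 0" by (rule nonneg[OF *]) (use xyz in simp)
  moreover have "p ^ Suc m > 0" using p xyz by simp
  ultimately have wp: "w p \<ge> 0" by (simp add: zero_le_divide_iff del: power_Suc)
  have *: "(z - y) * (w q / q ^ Suc m) \<le> 0" using q(3) ge by linarith
  have "w q / q ^ Suc m \<le> 0" by (rule nonpos[OF *]) (use xyz in simp)
  moreover have "q ^ Suc m > 0" using q xyz by simp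
  ultimately have wq: "w q \<le> 0" by (simp add: divide_le_0_iff del: power_Suc)
  \<comment> \<open>The coefficients \<open>(n - m) * b n\<close> are nonpositive up to
    \<open>M\<close> and nonnegative beyond, so \<open>w u / u ^ M\<close> is strictly increasing,
    which the signs at \<open>p\<close> and \<open>q\<close> rule out.\<close>
  have "w p * q ^ M < w q * p ^ M"
  proof (rule power_series_one_sign_change[OF w_sums _ _ k(1)])
    show "(real n - real m) * b n \<le> 0" if "n \<le> M" for n
      using that lo[of n] mid[of n]
      by (cases "n < m") (auto intro: mult_nonpos_nonneg mult_nonneg_nonpos)
    show "(real n - real m) * b n \<ge> 0" if "n > M" for n
      using that hi[of n] \<open>m \<le> M\<close> by auto
    show "(real k - real m) * b k \<noteq> 0" using k \<open>m \<le> M\<close> by auto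
  qed (use p q xyz in auto)
  moreover have "w p * q ^ M \<ge> 0" "w q * p ^ M \<le> 0"
    using wp wq p q xyz by (auto intro: mult_nonpos_nonneg)
  ultimately show False by linarith
qed

section \<open>The second derivative and its numerator\<close>

text \<open>The second derivative of \<open>frakH \<alpha>\<close> at \<open>t = 1/u\<close>,
  stripped of the positive factor \<open>t powr (\<alpha> - 3) / (exp u - 1) ^ 3\<close>.\<close>

definition frakH_num :: "real \<Rightarrow> real \<Rightarrow> real" where
  "frakH_num \<alpha> u = (\<alpha> - 1) * (\<alpha> - 2) * (exp u - 1)\<^sup>2
     + 2 * (\<alpha> - 2) * u * exp u * (exp u - 1) + u\<^sup>2 * exp u * (exp u + 1)"

lemma frakH_deriv:
  assumes t: "t > (0::real)"
  shows "(frakH \<alpha> has_real_derivative t powr (\<alpha> - 2) *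
      ((\<alpha> - 1) * (exp (1/t) - 1) + exp (1/t) / t) / (exp (1/t) - 1)\<^sup>2) (at t)"
proof -
  have E: "exp (1/t) - 1 > 0" using t by simp
  have pw: "t powr (\<alpha> - 1) = t powr (\<alpha> - 2) * t"
    using powr_add[of t "\<alpha> - 2" 1] t by (simp add: diff_add_eq)
  have "((\<lambda>t. t powr (\<alpha> - 1) / (exp (1 / t) - 1)) has_real_derivative
     ((\<alpha> - 1) * t powr (\<alpha> - 1 - 1) * (exp (1/t) - 1) - t powr (\<alpha> - 1) * (exp (1/t) * (- 1 / t^2)))
      / ((exp (1/t) - 1) * (exp (1/t) - 1))) (at t)"
    using t E by (auto intro!: derivative_eq_intros simp: power2_eq_square)
  also have "((\<alpha> - 1) * t powr (\<alpha> - 1 - 1) * (exp (1/t) - 1) - t powr (\<alpha> - 1) * (exp (1/t) * (- 1 / t^2)))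
      / ((exp (1/t) - 1) * (exp (1/t) - 1)) = t powr (\<alpha> - 2) *
      ((\<alpha> - 1) * (exp (1/t) - 1) + exp (1/t) / t) / (exp (1/t) - 1)\<^sup>2"
    using t unfolding pw by (simp add: power2_eq_square algebra_simps)
  finally show ?thesis by (simp add: frakH_def[abs_def])
qed

lemma frakH_deriv2:
  assumes t: "t > (0::real)"
  shows "((\<lambda>t. t powr (\<alpha> - 2) *
      ((\<alpha> - 1) * (exp (1/t) - 1) + exp (1/t) / t) / (exp (1/t) - 1)\<^sup>2) has_real_derivative
      t powr (\<alpha> - 3) * frakH_num \<alpha> (1/t) / (exp (1/t) - 1) ^ 3) (at t)"
proof -
  define u where "u = 1 / t"
  define E where "E = exp u"
  define d where "d = E - 1"
  define X where "X = t powr (\<alpha> - 3)"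
  have u: "u > 0" "t * u = 1" using t by (simp_all add: u_def)
  have d: "d > 0" using u by (simp add: d_def E_def)
  have pw: "t powr (\<alpha> - 2) = X * t"
    using powr_add[of t "\<alpha> - 3" 1] t by (simp add: X_def diff_add_eq)
  have dE: "((\<lambda>t. exp (1/t)) has_real_derivative - (E * u\<^sup>2)) (at t)"
    using t unfolding E_def u_def
    by (auto intro!: derivative_eq_intros simp: power2_eq_square)
  have dA: "((\<lambda>t. t powr (\<alpha> - 2)) has_real_derivative (\<alpha> - 2) * X) (at t)"
    using has_real_derivative_powr[OF t, of "\<alpha> - 2"] by (simp add: X_def)
  have dB: "((\<lambda>t. (\<alpha> - 1) * (exp (1/t) - 1) + exp (1/t) / t) has_real_derivative
      - (\<alpha> * E * u\<^sup>2) - E * u ^ 3) (at t)"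
    using t by (auto intro!: derivative_eq_intros dE
        simp: E_def u_def field_simps power2_eq_square power3_eq_cube)
  have dC: "((\<lambda>t. (exp (1/t) - 1)\<^sup>2) has_real_derivative - (2 * d * E * u\<^sup>2)) (at t)"
    using t by (auto intro!: derivative_eq_intros dE
        simp: d_def E_def u_def field_simps power2_eq_square)
  have nz: "(exp (1/t) - 1)\<^sup>2 \<noteq> 0" using t by simp
  define P where "P = (\<alpha> - 1) * (\<alpha> - 2) * d\<^sup>2 + 2 * (\<alpha> - 2) * u * E * d + u\<^sup>2 * E * (E + 1)"
  have P: "frakH_num \<alpha> (1/t) = P" by (simp add: frakH_num_def P_def E_def d_def u_def)
  \<comment> \<open>A polynomial identity modulo \<open>t * u = 1\<close> and
    \<open>d = E - 1\<close>. The factor \<open>d\<close> split off on the right lowers the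
    denominator from \<open>d ^ 4\<close> to \<open>d ^ 3\<close>.\<close>
  have "(((\<alpha> - 2) * X * ((\<alpha> - 1) * d + E * u) + (- (\<alpha> * E * u\<^sup>2) - E * u ^ 3) * (X * t)) * d\<^sup>2
      - X * t * ((\<alpha> - 1) * d + E * u) * - (2 * d * E * u\<^sup>2)) = X * P * d"
    using u(2) d_def unfolding P_def by algebra
  moreover have "X * P * d / (d\<^sup>2 * d\<^sup>2) = X * P / d ^ 3"
    using d by (simp add: field_simps power2_eq_square power3_eq_cube)
  ultimately have "(((\<alpha> - 2) * X * ((\<alpha> - 1) * d + E * u) + (- (\<alpha> * E * u\<^sup>2) - E * u ^ 3) * (X * t)) * d\<^sup>2
      - X * t * ((\<alpha> - 1) * d + E * u) * - (2 * d * E * u\<^sup>2)) / (d\<^sup>2 * d\<^sup>2) = X * P / d ^ 3"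
    by simp
  with DERIV_divide[OF DERIV_mult[OF dA dB] dC nz] show ?thesis
    unfolding P by (simp add: X_def[symmetric] pw d_def E_def u_def)
qed

lemma continuous_frakH_num: "continuous_on S (frakH_num \<alpha>)"
  unfolding frakH_num_def by (intro continuous_intros)

section \<open>Taylor coefficients of the numerator\<close>

text \<open>For \<open>n \<ge> 2\<close>, this is \<open>n!\<close> times the \<open>n\<close>-th
  Taylor coefficient of \<open>frakH_num \<alpha>\<close>, divided by \<open>2 ^ n - 2\<close>. The
  division makes the part involving \<open>\<alpha>\<close> affine in \<open>n\<close>, so that
  second differences in \<open>n\<close> are free of \<open>\<alpha>\<close>.\<close>

definition num_weight :: "real \<Rightarrow> nat \<Rightarrow> real" where
  "num_weight \<alpha> n = (\<alpha> - 1) * (\<alpha> - 2) + (\<alpha> - 2) * real n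
     + real n * (real n - 1) * (2 ^ n + 4) / (4 * (2 ^ n - 2))"

text \<open>The numerator vanishes to second order at 0, whereas the general formula would give
  \<open>- (\<alpha> - 1) * (\<alpha> - 2)\<close> at \<open>n = 0\<close>, and
  \<open>num_weight\<close> divides by zero at \<open>n = 1\<close>.\<close>

definition num_coeff :: "real \<Rightarrow> nat \<Rightarrow> real" where
  "num_coeff \<alpha> n = (if n < 2 then 0 else (2 ^ n - 2) * num_weight \<alpha> n / fact n)"

lemma exp_sums_real: "(\<lambda>n. x ^ n / fact n) sums exp (x::real)"
  using exp_converges[of x] by (simp add: scaleR_conv_of_real field_simps)

lemma exp_sums_mult: "(\<lambda>n. real n * x ^ n / fact n) sums (x * exp (x::real))"
proof -
  have "(\<lambda>n. real (Suc n) * x ^ Suc n / fact (Suc n)) sums (x * exp x)"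
    using sums_mult[OF exp_sums_real[of x], of x] by (simp add: field_simps del: of_nat_Suc)
  from sums_Suc[OF this] show ?thesis by simp
qed

lemma exp_sums_mult2: "(\<lambda>n. real n * (real n - 1) * x ^ n / fact n) sums (x\<^sup>2 * exp (x::real))"
proof -
  have *: "real (Suc n) * (real (Suc n) - 1) * x ^ Suc n / fact (Suc n) = x * (real n * x ^ n / fact n)" for n
    by (simp add: field_simps del: of_nat_Suc) (simp add: algebra_simps)
  have "(\<lambda>n. real (Suc n) * (real (Suc n) - 1) * x ^ Suc n / fact (Suc n)) sums (x * (x * exp x))"
    unfolding * by (rule sums_mult) (rule exp_sums_mult)
  from sums_Suc[OF this] show ?thesis by (simp add: power2_eq_square mult_ac)
qed

lemma frakH_num_sums: "(\<lambda>n. num_coeff \<alpha> n * u ^ n) sums frakH_num \<alpha> u"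
proof -
  define c where "c = (\<alpha> - 1) * (\<alpha> - 2)"
  have E2: "exp (2 * u) = exp u * exp u" by (simp flip: exp_add)
  \<comment> \<open>Multiplied out, the numerator is a constant plus a combination of
    \<open>x ^ k * exp x\<close> with \<open>k \<le> 2\<close>, at \<open>x = 2 * u\<close> and
    \<open>x = u\<close>. The \<open>1/4\<close> rewrites \<open>u\<^sup>2 * exp (2 * u)\<close> in
    terms of \<open>(2 * u)\<^sup>2\<close>.\<close>
  let ?g = "\<lambda>n. c * ((2 * u) ^ n / fact n) - 2 * c * (u ^ n / fact n) + (if n = 0 then c else 0)
     + ((\<alpha> - 2) * (real n * (2 * u) ^ n / fact n) - 2 * (\<alpha> - 2) * (real n * u ^ n / fact n))
     + ((1/4) * (real n * (real n - 1) * (2 * u) ^ n / fact n) + real n * (real n - 1) * u ^ n / fact n)"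
  have "?g sums (c * exp (2 * u) - 2 * c * exp u + c
     + ((\<alpha> - 2) * (2 * u * exp (2 * u)) - 2 * (\<alpha> - 2) * (u * exp u))
     + ((1/4) * ((2 * u)\<^sup>2 * exp (2 * u)) + u\<^sup>2 * exp u))"
    by (intro sums_add sums_diff sums_mult exp_sums_real exp_sums_mult exp_sums_mult2)
      (use sums_single[of 0 "\<lambda>_. c"] in simp)
  also have "(c * exp (2 * u) - 2 * c * exp u + c
     + ((\<alpha> - 2) * (2 * u * exp (2 * u)) - 2 * (\<alpha> - 2) * (u * exp u))
     + ((1/4) * ((2 * u)\<^sup>2 * exp (2 * u)) + u\<^sup>2 * exp u)) = frakH_num \<alpha> u"
    unfolding frakH_num_def c_def[symmetric] E2 by (simp add: power2_eq_square algebra_simps)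
  also have "?g = (\<lambda>n. num_coeff \<alpha> n * u ^ n)"
  proof
    fix n :: nat
    consider "n = 0" | "n = 1" | "n \<ge> 2" by linarith
    then show "?g n = num_coeff \<alpha> n * u ^ n"
    proof cases
      case 3
      then have "(2::real) ^ 2 \<le> 2 ^ n" by (intro power_increasing) auto
      then have "(2::real) ^ n - 2 \<noteq> 0" by auto
      then have eq: "(2 ^ n - 2) * num_weight \<alpha> n = (c + (\<alpha> - 2) * real n) * (2 ^ n - 2)
          + real n * (real n - 1) * (2 ^ n + 4) / 4"
        by (simp add: num_weight_def c_def field_simps)
      have "num_coeff \<alpha> n * u ^ n = ((c + (\<alpha> - 2) * real n) * (2 ^ n - 2)
          + real n * (real n - 1) * (2 ^ n + 4) / 4) * u ^ n / fact n"
        unfolding eq[symmetric] using 3 by (simp add: num_coeff_def)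
      also have "\<dots> = ?g n" using 3 by (simp add: power_mult_distrib field_simps)
      finally show ?thesis by simp
    qed (simp_all add: num_coeff_def)
  qed
  finally show ?thesis .
qed

section \<open>Convexity and signs of the weights\<close>

text \<open>The bound fails at 3, which is why \<open>num_weight_convex\<close> evaluates
  \<open>n = 2\<close> and \<open>n = 3\<close> separately.\<close>

lemma pow2_ge: "n \<ge> 4 \<Longrightarrow> (2::real) ^ n \<ge> 3 * real n + 1"
  by (induction n rule: dec_induct) auto

lemma num_weight_convex:
  assumes "n \<ge> 2"
  shows "2 * num_weight \<alpha> (Suc n) \<le> num_weight \<alpha> n + num_weight \<alpha> (Suc (Suc n))"
proof -
  consider "n = 2" | "n = 3" | "n \<ge> 4" using assms by linarith
  then show ?thesis
  proof cases
    case 3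
    define x where "x = (2::real) ^ n"
    have x: "x \<ge> 3 * real n + 1" "x > 4" using pow2_ge[OF 3] 3 by (simp_all add: x_def)
    define r where "r = real n"
    have r: "r \<ge> 4" using 3 by (simp add: r_def)
    have "x * x \<ge> (3 * r + 1) * x" using x by (intro mult_right_mono) (auto simp: r_def)
    then have key: "x * x - 1 \<ge> 3 * r * x" using x by (simp add: algebra_simps)
    have "num_weight \<alpha> n + num_weight \<alpha> (Suc (Suc n)) - 2 * num_weight \<alpha> (Suc n)
      = r * (r - 1) * (x + 4) / (4 * (x - 2)) + (r + 2) * (r + 1) * (4 * x + 4) / (4 * (4 * x - 2))
        - 2 * ((r + 1) * r * (2 * x + 4) / (4 * (2 * x - 2)))"
      by (simp add: num_weight_def x_def r_def algebra_simps)
    \<comment> \<open>By \<open>(x + 4) / (4 * (x - 2)) = 1/4 + 3 / (2 * (x - 2))\<close>, the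
      second difference of \<open>n * (n - 1) / 4\<close> contributes \<open>1/2\<close>; the rest
      is grouped by \<open>r * (r - 1)\<close>.\<close>
    also have "\<dots> = 1/2 * (1 + 3 * (r * (r - 1) * (1 / ((x - 1) * (x - 2)) + 1 / (4 * x - 2))
        + (2 * r + 1) / (2 * x - 1) - 2 * r / (x - 1)))"
      using x by (simp add: divide_simps) algebra
    \<comment> \<open>The summand 1 absorbs the only negative fraction; the resulting numerator is
      nonnegative by \<open>key\<close>.\<close>
    also have "\<dots> = 1/2 * (3 * (r * (r - 1) * (1 / ((x - 1) * (x - 2)) + 1 / (4 * x - 2)))
        + 2 * (x * x - 1 - 3 * r * x) / ((2 * x - 1) * (x - 1)))"
      using x by (simp add: divide_simps) algebra
    also have "\<dots> \<ge> 0"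
      using x r key by (intro mult_nonneg_nonneg add_nonneg_nonneg divide_nonneg_nonneg) auto
    finally show ?thesis by simp
  qed (simp_all add: num_weight_def field_simps)
qed

lemma num_weight_diff_mono:
  assumes "2 \<le> i" "i \<le> j"
  shows "num_weight \<alpha> (Suc i) - num_weight \<alpha> i \<le> num_weight \<alpha> (Suc j) - num_weight \<alpha> j"
  using assms(2)
proof (induction j rule: dec_induct)
  case (step j)
  with num_weight_convex[of j \<alpha>] assms(1) show ?case by simp
qed simp

text \<open>The step from \<open>M\<close> to \<open>Suc M\<close> goes up, and by convexity all
  later steps are at least as large.\<close>

lemma num_weight_stays_pos:
  assumes "2 \<le> M" "num_weight \<alpha> M \<le> 0" "num_weight \<alpha> (Suc M) > 0" "n > M"
  shows "num_weight \<alpha> n > 0"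
proof -
  from \<open>n > M\<close> have "Suc M \<le> n" by simp
  then show ?thesis
  proof (induction n rule: dec_induct)
    case (step j)
    with num_weight_diff_mono[of M j \<alpha>] assms show ?case by simp
  qed (use assms in simp)
qed

text \<open>The quadratic part, about \<open>n * (n - 1) / 4\<close>, outgrows the affine
  part.\<close>

lemma num_weight_ex_pos: "\<exists>n\<ge>m. num_weight \<alpha> n > 0"
proof -
  have "\<forall>\<^sub>F n in sequentially. num_weight \<alpha> n > 0"
    unfolding num_weight_def by real_asymp
  then show ?thesis by (metis eventually_sequentially nle_le)
qed

lemma num_weight_2: "num_weight \<alpha> 2 = \<alpha> * (\<alpha> - 1)"
  and num_weight_3: "num_weight \<alpha> 3 = \<alpha>\<^sup>2 - 1"
  by (simp_all add: num_weight_def power2_eq_square algebra_simps)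

lemma num_coeff_sgn: "n \<ge> 2 \<Longrightarrow> sgn (num_coeff \<alpha> n) = sgn (num_weight \<alpha> n)"
proof -
  assume n: "n \<ge> 2"
  then have "(2::real) ^ 2 \<le> 2 ^ n" by (intro power_increasing) auto
  then have "sgn ((2::real) ^ n - 2) = 1" by auto
  with n show ?thesis by (simp add: num_coeff_def sgn_mult sgn_divide)
qed

section \<open>The numerator near 0 and at infinity, and a point where it is negative\<close>

text \<open>The term \<open>u\<^sup>2 * exp (2 * u)\<close> dominates.\<close>

lemma frakH_num_eventually_pos: "\<forall>\<^sub>F u in at_top. frakH_num \<alpha> u > 0"
  unfolding frakH_num_def by real_asymp

lemma frakH_num_ex_pos: obtains v where "v > u" "frakH_num \<alpha> v > 0"
proof -
  have "\<forall>\<^sub>F v in at_top. v > u \<and> frakH_num \<alpha> v > 0"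
    by (intro eventually_conj eventually_gt_at_top frakH_num_eventually_pos)
  with that show ?thesis by (auto dest: eventually_happens)
qed

text \<open>The limit is the Taylor coefficient of order 2. It decides the sign of the numerator
  near 0 unless \<open>\<alpha>\<close> is 0 or 1.\<close>

lemma frakH_num_asymp_0:
  "((\<lambda>u. frakH_num \<alpha> u / u\<^sup>2) \<longlongrightarrow> \<alpha> * (\<alpha> - 1)) (at_right 0)"
proof -
  have "((\<lambda>u. frakH_num \<alpha> u / u\<^sup>2) \<longlongrightarrow> (\<alpha> - 1) * (\<alpha> - 2) + 2 * \<alpha> - 2) (at_right 0)"
    unfolding frakH_num_def by real_asymp
  also have "(\<alpha> - 1) * (\<alpha> - 2) + 2 * \<alpha> - 2 = \<alpha> * (\<alpha> - 1)" by algebra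
  finally show ?thesis .
qed

text \<open>
  As a polynomial in \<open>\<alpha>\<close>, the numerator has leading coefficient \<open>(exp u - 1)\<^sup>2\<close> and two real
  roots with midpoint \<open>3/2 - p u\<close>, where \<open>p u = u * exp u / (exp u - 1)\<close>.
\<close>

lemma frakH_num_neg_midpoint:
  assumes "\<alpha> < 1/2"
  obtains u where "u > 0" "frakH_num \<alpha> u < 0"
proof -
  define p where "p u = u * exp u / (exp u - 1)" for u :: real
  \<comment> \<open>On the positive axis \<open>p\<close> runs continuously from 1 to infinity, so
    it attains \<open>3/2 - \<alpha>\<close>, which exceeds 1 because
    \<open>\<alpha> < 1/2\<close>.\<close>
  have "(p \<longlongrightarrow> 1) (at_right 0)" unfolding p_def by real_asymp
  then have "\<forall>\<^sub>F u in at_right 0. p u < 3/2 - \<alpha>"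
    using assms by (auto dest!: order_tendstoD(2)[of _ _ _ "3/2 - \<alpha>"])
  then have "\<forall>\<^sub>F u in at_right 0. u > 0 \<and> p u < 3/2 - \<alpha>"
    by (intro eventually_conj eventually_at_right_less)
  then obtain a where a: "a > 0" "p a < 3/2 - \<alpha>"
    by (auto dest: eventually_happens)
  have "filterlim p at_top at_top" unfolding p_def by real_asymp
  then have "\<forall>\<^sub>F u in at_top. u > a \<and> p u > 3/2 - \<alpha>"
    by (intro eventually_conj eventually_gt_at_top) (simp add: filterlim_at_top_dense)
  then obtain b where b: "b > a" "p b > 3/2 - \<alpha>"
    by (auto dest: eventually_happens)
  have "continuous_on {a..b} p"
    unfolding p_def using a by (auto intro!: continuous_intros)
  then obtain u where u: "a \<le> u" "p u = 3/2 - \<alpha>"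
    using IVT'[of p a "3/2 - \<alpha>" b] a b by auto
  then have "u > 0" using a by simp
  define E where "E = exp u"
  have E: "E > 1 + u" using exp_minus_greater[of "-u"] \<open>u > 0\<close> by (simp add: E_def)
  define d where "d = E - 1"
  have d: "d > u" "E = d + 1" using E by (simp_all add: d_def)
  have al: "\<alpha> = 3/2 - p u" using u by simp
  have pd: "p u = u * (d + 1) / d" by (simp add: p_def d_def E_def)
  \<comment> \<open>This is the minimum of the quadratic in \<open>\<alpha>\<close>; it is negative
    because \<open>exp u > 1 + u\<close> makes \<open>d - u\<close> positive.\<close>
  have "frakH_num \<alpha> u = - (d\<^sup>2 / 4 + u * (d + 1) * (d - u))"
    unfolding frakH_num_def E_def[symmetric] al pd d(2) using d(1) \<open>u > 0\<close>
    by (simp add: field_simps power2_eq_square)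
  moreover have "u * (d + 1) * (d - u) > 0" "d\<^sup>2 / 4 \<ge> 0" using d(1) \<open>u > 0\<close> by simp_all
  ultimately have "frakH_num \<alpha> u < 0" by linarith
  then show ?thesis using that \<open>u > 0\<close> by blast
qed

section \<open>Signs and positive zeros of the numerator\<close>

lemma num_coeff_nonpos_iff: "n \<ge> 2 \<Longrightarrow> num_coeff \<alpha> n \<le> 0 \<longleftrightarrow> num_weight \<alpha> n \<le> 0"
  and num_coeff_pos_iff: "n \<ge> 2 \<Longrightarrow> num_coeff \<alpha> n > 0 \<longleftrightarrow> num_weight \<alpha> n > 0"
  using num_coeff_sgn[of n \<alpha>] by (simp_all add: sgn_if split: if_splits)

lemma num_coeff_small: "n < 2 \<Longrightarrow> num_coeff \<alpha> n = 0"
  by (simp add: num_coeff_def)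

text \<open>\<open>M\<close> is the predecessor of the first index from \<open>m\<close> on with
  positive weight; after that, convexity keeps the weights positive.\<close>

lemma num_weight_last_sign_change:
  assumes "2 \<le> m" "num_weight \<alpha> m \<le> 0"
  obtains M where "m \<le> M" "\<And>n. m \<le> n \<Longrightarrow> n \<le> M \<Longrightarrow> num_weight \<alpha> n \<le> 0"
    "\<And>n. n > M \<Longrightarrow> num_weight \<alpha> n > 0"
proof -
  define L where "L = (LEAST n. n \<ge> m \<and> num_weight \<alpha> n > 0)"
  have L: "L \<ge> m" "num_weight \<alpha> L > 0"
    using LeastI_ex[OF num_weight_ex_pos[of m \<alpha>, unfolded Bex_def]] by (auto simp: L_def)
  have below: "num_weight \<alpha> n \<le> 0" if "m \<le> n" "n < L" for n
    using not_less_Least[of n "\<lambda>n. n \<ge> m \<and> num_weight \<alpha> n > 0"] that by (auto simp: L_def)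
  have "L \<noteq> m" using L assms by auto
  then obtain M where M: "L = Suc M" "m \<le> M" using L(1) by (cases L) auto
  show ?thesis
  proof (rule that[OF M(2)])
    show "num_weight \<alpha> n \<le> 0" if "m \<le> n" "n \<le> M" for n using below that M by auto
    show "num_weight \<alpha> n > 0" if "n > M" for n
      using num_weight_stays_pos[of M \<alpha> n] below[of M] L M assms(1) that by auto
  qed
qed

lemma frakH_num_nonneg:
  assumes "\<alpha> \<ge> 1" "u \<ge> 0"
  shows "frakH_num \<alpha> u \<ge> 0"
proof -
  have weight: "num_weight \<alpha> n \<ge> 0" if "n \<ge> 2" for n
    using that
  proof (induction n rule: dec_induct)
    case (step n)
    have "num_weight \<alpha> 3 - num_weight \<alpha> 2 = \<alpha> - 1"
      unfolding num_weight_2 num_weight_3 by (simp add: power2_eq_square algebra_simps)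
    with num_weight_diff_mono[of 2 n \<alpha>] step assms show ?case by (simp add: numeral_eq_Suc)
  qed (use assms in \<open>simp add: num_weight_2\<close>)
  have "num_coeff \<alpha> n \<ge> 0" for n
    using weight[of n] num_coeff_small[of n \<alpha>] num_coeff_sgn[of n \<alpha>]
    by (cases "n < 2") (auto simp: sgn_if split: if_splits)
  then show ?thesis
    using sums_le[OF _ sums_zero frakH_num_sums[of \<alpha> u]] assms(2) by simp
qed

lemma frakH_num_one_zero:
  assumes "0 \<le> \<alpha>" "\<alpha> < 1"
  obtains c where "c > 0" "\<And>u. u > 0 \<Longrightarrow> sgn (frakH_num \<alpha> u) = sgn (u - c)"
proof -
  let ?N = "frakH_num \<alpha>"
  have "num_weight \<alpha> 2 \<le> 0" using assms by (simp add: num_weight_2 mult_nonneg_nonpos)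
  then obtain M where M: "2 \<le> M" "\<And>n. 2 \<le> n \<Longrightarrow> n \<le> M \<Longrightarrow> num_weight \<alpha> n \<le> 0"
    "\<And>n. n > M \<Longrightarrow> num_weight \<alpha> n > 0"
    using num_weight_last_sign_change[of 2 \<alpha>] by auto
  have lo: "num_coeff \<alpha> n \<le> 0" if "n \<le> M" for n
    using M(2)[of n] that num_coeff_nonpos_iff[of n \<alpha>] num_coeff_small[of n \<alpha>] by fastforce
  have hi: "num_coeff \<alpha> n > 0" if "n > M" for n
    using M(1) M(3)[of n] that num_coeff_pos_iff[of n \<alpha>] by auto
  \<comment> \<open>Thus \<open>?N u / u ^ M\<close> is strictly increasing, so any positive zero is
    unique and fixes the sign on both sides.\<close>
  have mono: "?N u * v ^ M < ?N v * u ^ M" if "0 < u" "u < v" for u v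
    by (rule power_series_one_sign_change[OF frakH_num_sums lo less_imp_le[OF hi] lessI])
      (use hi[of "Suc M"] that in auto)
  \<comment> \<open>At \<open>\<alpha> = 0\<close> the limit of \<open>?N u / u\<^sup>2\<close> is 0
    and gives no sign, so the midpoint argument steps in.\<close>
  obtain a where a: "a > 0" "?N a < 0"
  proof (cases "\<alpha> = 0")
    case True
    then show ?thesis using frakH_num_neg_midpoint[of \<alpha>] that by auto
  next
    case False
    with assms have "\<alpha> * (\<alpha> - 1) < 0" by (simp add: mult_pos_neg)
    from order_tendstoD(2)[OF frakH_num_asymp_0 this]
    have "\<forall>\<^sub>F u in at_right 0. u > 0 \<and> ?N u / u\<^sup>2 < 0"
      by (intro eventually_conj eventually_at_right_less)
    then obtain u where "u > 0" "?N u / u\<^sup>2 < 0" by (auto dest: eventually_happens)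
    then show ?thesis using that by (auto simp: divide_less_0_iff)
  qed
  obtain b where b: "b > a" "?N b > 0" by (rule frakH_num_ex_pos)
  obtain c where c: "a \<le> c" "?N c = 0"
    using IVT'[of ?N a 0 b] a b continuous_frakH_num by auto
  show ?thesis
  proof (rule that[of c])
    show "sgn (?N u) = sgn (u - c)" if "u > 0" for u
    proof (cases u c rule: linorder_cases)
      case less
      with mono[of u c] c a that show ?thesis by (auto simp: mult_less_0_iff)
    next
      case greater
      with mono[of c u] c a that show ?thesis by (auto simp: zero_less_mult_iff)
    qed (use c in simp)
  qed (use a c in simp)
qed

lemma frakH_num_two_zeros:
  assumes "\<alpha> < 0"
  obtains c d where "0 < c" "c < d" "\<And>u. u > 0 \<Longrightarrow> sgn (frakH_num \<alpha> u) = sgn ((u - c) * (u - d))"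
proof -
  let ?N = "frakH_num \<alpha>"
  obtain q where q: "q > 0" "?N q < 0" using frakH_num_neg_midpoint[of \<alpha>] assms by auto
  \<comment> \<open>Without a negative weight the whole series would be nonnegative at
    \<open>q\<close>.\<close>
  have "\<exists>n\<ge>2. num_weight \<alpha> n < 0"
  proof (rule ccontr)
    assume *: "\<not> ?thesis"
    have "num_coeff \<alpha> n \<ge> 0" for n
      using * num_coeff_small[of n \<alpha>] num_coeff_sgn[of n \<alpha>]
      by (cases "n < 2") (force simp: sgn_if not_less split: if_splits)+
    then have "?N q \<ge> 0"
      using sums_le[OF _ sums_zero frakH_num_sums[of \<alpha> q]] q(1) by simp
    with q show False by simp
  qed
  then have ex: "\<exists>n. n \<ge> 2 \<and> num_weight \<alpha> n < 0" by blast
  \<comment> \<open>The first negative weight \<open>m\<close> and the last sign change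
    \<open>M\<close> give the coefficient pattern nonnegative, nonpositive, positive.\<close>
  define m where "m = (LEAST n. n \<ge> 2 \<and> num_weight \<alpha> n < 0)"
  have m: "m \<ge> 2" "num_weight \<alpha> m < 0" using LeastI_ex[OF ex] by (auto simp: m_def)
  have below: "num_weight \<alpha> n \<ge> 0" if "2 \<le> n" "n < m" for n
    using not_less_Least[of n "\<lambda>n. n \<ge> 2 \<and> num_weight \<alpha> n < 0"] that by (auto simp: m_def)
  obtain M where M: "m \<le> M" "\<And>n. m \<le> n \<Longrightarrow> n \<le> M \<Longrightarrow> num_weight \<alpha> n \<le> 0"
    "\<And>n. n > M \<Longrightarrow> num_weight \<alpha> n > 0"
    using num_weight_last_sign_change[of m \<alpha>] m by auto
  have lo: "num_coeff \<alpha> n \<ge> 0" if "n < m" for n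
    using below[of n] that num_coeff_small[of n \<alpha>] num_coeff_sgn[of n \<alpha>]
    by (cases "n < 2") (auto simp: sgn_if split: if_splits)
  have mid: "num_coeff \<alpha> n \<le> 0" if "m \<le> n" "n \<le> M" for n
    using M(2)[of n] that m(1) num_coeff_nonpos_iff[of n \<alpha>] by auto
  have hi: "num_coeff \<alpha> n > 0" if "n > M" for n
    using M(1) M(3)[of n] m(1) that num_coeff_pos_iff[of n \<alpha>] by auto
  \<comment> \<open>\<open>H\<close> has the sign of \<open>?N\<close> on the positive axis, and
    once it fails to decrease it increases strictly from there on.\<close>
  define H where "H u = ?N u / u ^ m" for u
  have H: "0 \<le> H u \<longleftrightarrow> 0 \<le> ?N u" "H u \<le> 0 \<longleftrightarrow> ?N u \<le> 0" if "u > 0" for u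
    using zero_less_power[OF that, of m]
    by (auto simp: H_def zero_le_divide_iff divide_le_0_iff simp del: zero_less_power)
  have quasiconvex: "H y < H z" if "0 < x" "x < y" "y < z" "H x \<le> H y" for x y z
    unfolding H_def
    by (rule power_series_two_sign_changes_quasiconvex[OF frakH_num_sums lo mid
          less_imp_le[OF hi] M(1) lessI])
      (use hi[of "Suc M"] that in \<open>auto simp: H_def\<close>)
  have "\<alpha> * (\<alpha> - 1) > 0" using assms by (simp add: mult_neg_neg)
  from order_tendstoD(1)[OF frakH_num_asymp_0 this]
  have "\<forall>\<^sub>F u in at_right 0. u \<in> {0<..<q} \<and> ?N u / u\<^sup>2 > 0"
    using q(1) by (intro eventually_conj eventually_at_right_real)
  then obtain p where "p \<in> {0<..<q}" "?N p / p\<^sup>2 > 0" by (auto dest: eventually_happens)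
  then have p: "0 < p" "p < q" "?N p > 0" by (auto simp: zero_less_divide_iff)
  obtain r where r: "r > q" "?N r > 0" by (rule frakH_num_ex_pos)
  obtain c where c: "p \<le> c" "c \<le> q" "?N c = 0"
    using IVT2'[of ?N q 0 p] p q continuous_frakH_num by auto
  obtain d where d: "q \<le> d" "d \<le> r" "?N d = 0"
    using IVT'[of ?N q 0 r] r q continuous_frakH_num by auto
  have cd: "0 < c" "c < q" "q < d" using c d p q by (auto simp: order.order_iff_strict)
  have Hcd: "H c = 0" "H d = 0" "H q < 0" using c d q H(1)[OF q(1)]
    by (simp_all add: H_def zero_less_power divide_neg_pos)
  show ?thesis
  proof (rule that[of c d])
    show "sgn (?N u) = sgn ((u - c) * (u - d))" if "u > 0" for u
    proof -
      \<comment> \<open>On each open interval a wrong sign of \<open>H u\<close> contradicts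
        \<open>quasiconvex\<close>, applied to \<open>u\<close>, the point \<open>q\<close> with
        \<open>H q < 0\<close>, and the zero \<open>c\<close> or \<open>d\<close> on the same side
        of \<open>q\<close> as \<open>u\<close>.\<close>
      consider "u < c" | "u = c" | "c < u" "u < q" | "u = q" | "q < u" "u < d" | "u = d" | "d < u"
        by linarith
      then show ?thesis
      proof cases
        case 1
        then have "\<not> H u \<le> 0" using quasiconvex[of u c q] that cd Hcd by auto
        with 1 cd H(2)[OF that] show ?thesis by (simp add: sgn_mult)
      next
        case 3
        then have "\<not> 0 \<le> H u" using quasiconvex[of c u q] cd Hcd by auto
        with 3 cd H(1)[OF that] show ?thesis by (simp add: sgn_mult)
      next
        case 5
        then have "\<not> 0 \<le> H u" using quasiconvex[of q u d] q(1) Hcd by auto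
        with 5 cd H(1)[OF that] show ?thesis by (simp add: sgn_mult)
      next
        case 7
        then have "\<not> H u \<le> 0" using quasiconvex[of q d u] q(1) cd Hcd by auto
        with 7 cd H(2)[OF that] show ?thesis by (simp add: sgn_mult)
      qed (use c d q cd in \<open>auto simp: sgn_mult\<close>)
    qed
  qed (use cd in auto)
qed

section \<open>Inflection points as sign changes of the numerator\<close>

text \<open>Allows the second derivative to be replaced by the numerator, and the numerator by a
  product of factors \<open>1/s - c\<close>.\<close>

lemma changes_sign_at_cong:
  assumes "\<forall>\<^sub>F y in nhds x. sgn (f y) = sgn (g y)" "changes_sign_at f x"
  shows "changes_sign_at g x"
proof -
  obtain d where d: "d > 0" "\<And>y. dist y x < d \<Longrightarrow> sgn (f y) = sgn (g y)"
    using assms(1) unfolding eventually_nhds_metric by blast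
  obtain e where e: "e > 0" "(\<forall>y\<in>{x - e<..<x}. f y < 0) \<and> (\<forall>y\<in>{x<..<x + e}. f y > 0)
          \<or> (\<forall>y\<in>{x - e<..<x}. f y > 0) \<and> (\<forall>y\<in>{x<..<x + e}. f y < 0)"
    using assms(2) unfolding changes_sign_at_def by blast
  define r where "r = min d e"
  have r: "r > 0" "r \<le> d" "r \<le> e" using d(1) e(1) by (auto simp: r_def)
  have "f y < 0 \<longleftrightarrow> g y < 0" "f y > 0 \<longleftrightarrow> g y > 0"
    if "y \<in> {x - r<..<x} \<union> {x<..<x + r}" for y
  proof -
    have "dist y x < d" using that r by (auto simp: dist_real_def)
    from d(2)[OF this] show "f y < 0 \<longleftrightarrow> g y < 0" "f y > 0 \<longleftrightarrow> g y > 0"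
      by (metis sgn_less, metis sgn_greater)
  qed
  moreover have "{x - r<..<x} \<subseteq> {x - e<..<x}" "{x<..<x + r} \<subseteq> {x<..<x + e}" using r by auto
  ultimately have "(\<forall>y\<in>{x - r<..<x}. g y < 0) \<and> (\<forall>y\<in>{x<..<x + r}. g y > 0)
          \<or> (\<forall>y\<in>{x - r<..<x}. g y > 0) \<and> (\<forall>y\<in>{x<..<x + r}. g y < 0)"
    using e(2) by (meson UnI1 UnI2 subsetD)
  with r(1) show ?thesis unfolding changes_sign_at_def by blast
qed

text \<open>At a nonzero value continuity makes the sign locally constant, so a constant function
  would have to change sign.\<close>

lemma changes_sign_at_isCont_zero:
  assumes "isCont g x" "changes_sign_at g x"
  shows "g x = 0"
proof (rule ccontr)
  assume "g x \<noteq> 0"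
  have lim: "(g \<longlongrightarrow> g x) (nhds x)"
    using assms(1) unfolding isCont_def tendsto_at_iff_tendsto_nhds .
  have "\<forall>\<^sub>F y in nhds x. sgn (g y) = sgn (g x)"
  proof (cases "g x > 0")
    case True
    from order_tendstoD(1)[OF lim True] show ?thesis
      by eventually_elim (simp add: True)
  next
    case False
    with \<open>g x \<noteq> 0\<close> have neg: "g x < 0" by simp
    from order_tendstoD(2)[OF lim neg] show ?thesis
      by eventually_elim (simp add: neg)
  qed
  then have "changes_sign_at (\<lambda>_. g x) x" by (rule changes_sign_at_cong) (rule assms(2))
  then obtain e where e: "e > 0" "(\<forall>y\<in>{x - e<..<x}. g x < 0) \<and> (\<forall>y\<in>{x<..<x + e}. g x > 0)
          \<or> (\<forall>y\<in>{x - e<..<x}. g x > 0) \<and> (\<forall>y\<in>{x<..<x + e}. g x < 0)"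
    unfolding changes_sign_at_def by blast
  have "\<exists>y>x - e. y < x" "\<exists>y>x. y < x + e"
    using dense[of "x - e" x] dense[of x "x + e"] e(1) by simp_all
  with e(2) show False by (auto dest: less_asym)
qed

lemma inflection_point_frakH_iff:
  assumes t: "t > 0"
  shows "inflection_point (frakH \<alpha>) t \<longleftrightarrow> changes_sign_at (\<lambda>s. frakH_num \<alpha> (1/s)) t"
proof -
  define f1 where "f1 t = t powr (\<alpha> - 2) *
      ((\<alpha> - 1) * (exp (1/t) - 1) + exp (1/t) / t) / (exp (1/t) - 1)\<^sup>2" for t
  define f2 where "f2 t = t powr (\<alpha> - 3) * frakH_num \<alpha> (1/t) / (exp (1/t) - 1) ^ 3" for t
  have d1: "(frakH \<alpha> has_real_derivative f1 s) (at s)" if "s > 0" for s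
    using frakH_deriv[OF that] by (simp add: f1_def)
  \<comment> \<open>\<open>deriv (frakH \<alpha>)\<close> is known to equal \<open>f1\<close> only
    on the open half-line, which suffices for transferring the derivative.\<close>
  have d2: "(deriv (frakH \<alpha>) has_real_derivative f2 s) (at s)" if "s > 0" for s
    by (rule has_field_derivative_transform_within_open[of f1 _ s "{0<..}"])
      (use that frakH_deriv2[OF that] DERIV_imp_deriv[OF d1] in
        \<open>auto simp: f1_def[abs_def] f2_def\<close>)
  have pos: "\<forall>\<^sub>F y in nhds t. y > 0"
    using t by (intro eventually_nhds_in_open[of "{0<..}", simplified]) auto
  have diff: "\<forall>\<^sub>F y in nhds t. frakH \<alpha> differentiable at y \<and> deriv (frakH \<alpha>) differentiable at y"
    using pos by eventually_elim (use d1 d2 real_differentiable_def in blast)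
  have ev: "\<forall>\<^sub>F y in nhds t. sgn (deriv (deriv (frakH \<alpha>)) y) = sgn (frakH_num \<alpha> (1/y))"
    using pos
  proof eventually_elim
    case (elim y)
    then have "sgn (f2 y) = sgn (frakH_num \<alpha> (1/y))"
      by (simp add: f2_def sgn_mult sgn_divide)
    then show ?case using DERIV_imp_deriv[OF d2[OF elim]] by simp
  qed
  then have ev': "\<forall>\<^sub>F y in nhds t. sgn (frakH_num \<alpha> (1/y)) = sgn (deriv (deriv (frakH \<alpha>)) y)"
    by eventually_elim simp
  have "changes_sign_at (deriv (deriv (frakH \<alpha>))) t \<longleftrightarrow>
      changes_sign_at (\<lambda>s. frakH_num \<alpha> (1/s)) t"
    using changes_sign_at_cong[OF ev] changes_sign_at_cong[OF ev'] by blast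
  with diff show ?thesis by (simp add: inflection_point_def)
qed

lemma inflection_point_frakH_imp_zero:
  assumes "t > 0" "inflection_point (frakH \<alpha>) t"
  shows "frakH_num \<alpha> (1/t) = 0"
proof (rule changes_sign_at_isCont_zero[where g = "\<lambda>s. frakH_num \<alpha> (1/s)" and x = t])
  show "changes_sign_at (\<lambda>s. frakH_num \<alpha> (1/s)) t"
    using assms inflection_point_frakH_iff by blast
  show "isCont (\<lambda>s. frakH_num \<alpha> (1/s)) t"
    using assms(1) unfolding frakH_num_def by (intro continuous_intros) auto
qed

section \<open>Counting the inflection points\<close>

lemma frakH_unique_inflection_point:
  assumes "0 \<le> \<alpha>" "\<alpha> < 1"
  shows "\<exists>!t. t \<in> {0<..} \<and> inflection_point (frakH \<alpha>) t"
proof -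
  obtain c where c: "c > 0" "\<And>u. u > 0 \<Longrightarrow> sgn (frakH_num \<alpha> u) = sgn (u - c)"
    using frakH_num_one_zero[OF assms] by blast
  show ?thesis
  proof (rule ex1I[of _ "1/c"])
    have "changes_sign_at (\<lambda>s. 1/s - c) (1/c)"
      unfolding changes_sign_at_def using c(1)
    \<comment> \<open>With radius \<open>1/c\<close> the left interval ends exactly at 0, so
      \<open>1/y\<close> stays positive. Taking reciprocals reverses the order, hence the change is
      from positive to negative.\<close>
    proof (intro exI[of _ "1/c"] conjI disjI2 ballI)
      fix y assume "y \<in> {1/c - 1/c<..<1/c}"
      with c(1) show "1/y - c > 0" by (auto simp: field_simps)
    next
      fix y assume y: "y \<in> {1/c<..<1/c + 1/c}"
      moreover from this have "y > 0" using c(1) by (auto intro: less_trans[of 0 "1/c"])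
      ultimately show "1/y - c < 0" using c(1) by (auto simp: field_simps)
    qed (use c(1) in simp)
    moreover have "\<forall>\<^sub>F y in nhds (1/c). y > 0"
      using c by (intro eventually_nhds_in_open[of "{0<..}", simplified]) auto
    then have "\<forall>\<^sub>F y in nhds (1/c). sgn (1/y - c) = sgn (frakH_num \<alpha> (1/y))"
      by eventually_elim (simp add: c(2))
    ultimately have "changes_sign_at (\<lambda>s. frakH_num \<alpha> (1/s)) (1/c)"
      by (rule changes_sign_at_cong[rotated])
    with c(1) show "1/c \<in> {0<..} \<and> inflection_point (frakH \<alpha>) (1/c)"
      by (simp add: inflection_point_frakH_iff)
  next
    fix t assume t: "t \<in> {0<..} \<and> inflection_point (frakH \<alpha>) t"
    then have "sgn (1/t - c) = 0"
      using inflection_point_frakH_imp_zero[of t \<alpha>] c(2)[of "1/t"] by simp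
    then show "t = 1/c" using t by (auto simp: sgn_zero_iff)
  qed
qed

lemma frakH_two_inflection_points:
  assumes "\<alpha> < 0"
  shows "card {t \<in> {0<..}. inflection_point (frakH \<alpha>) t} = 2"
proof -
  obtain c d where c: "0 < c" "c < d"
      "\<And>u. u > 0 \<Longrightarrow> sgn (frakH_num \<alpha> u) = sgn ((u - c) * (u - d))"
    using frakH_num_two_zeros[OF assms] by blast
  have infl: "inflection_point (frakH \<alpha>) x"
    if "x > 0" "changes_sign_at (\<lambda>s. (1/s - c) * (1/s - d)) x" for x
  proof -
    have "\<forall>\<^sub>F y in nhds x. y > 0"
      using that by (intro eventually_nhds_in_open[of "{0<..}", simplified]) auto
    then have "\<forall>\<^sub>F y in nhds x. sgn ((1/y - c) * (1/y - d)) = sgn (frakH_num \<alpha> (1/y))"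
      by eventually_elim (simp add: c(3))
    from changes_sign_at_cong[OF this that(2)] that(1) show ?thesis
      by (simp add: inflection_point_frakH_iff)
  qed
  have inv: "1/d < 1/c" "1/d > 0" using c by (auto simp: field_simps)
  \<comment> \<open>The bound \<open>1/d\<close> keeps the interval around \<open>1/d\<close>
    positive; the bound \<open>1/c - 1/d\<close> keeps each open interval clear of the other
    zero.\<close>
  define e where "e = min (1/d) (1/c - 1/d)"
  have e: "e > 0" "e \<le> 1/d" "e \<le> 1/c - 1/d" using inv by (auto simp: e_def)
  have lt: "1/y < x" if "1/x < y" "x > 0" for x y :: real
    using that less_imp_inverse_less[of "1/x" y] by (simp add: field_simps)
  have gt: "x < 1/y" if "y < 1/x" "y > 0" for x y :: real
    using that less_imp_inverse_less[of y "1/x"] by (simp add: field_simps)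
  have "changes_sign_at (\<lambda>s. (1/s - c) * (1/s - d)) (1/d)"
    unfolding changes_sign_at_def
  proof (intro exI[of _ e] conjI disjI2 ballI)
    fix y assume y: "y \<in> {1/d - e<..<1/d}"
    then have "1/y > d" using e gt[of y d] by auto
    with c(2) show "(1/y - c) * (1/y - d) > 0" by simp
  next
    fix y assume y: "y \<in> {1/d<..<1/d + e}"
    then have "1/y < d" "1/y > c" using e inv c(1,2) lt[of d y] gt[of y c] by auto
    with c(2) show "(1/y - c) * (1/y - d) < 0" by (simp add: mult_pos_neg)
  qed (use e in simp)
  with inv(2) have i1: "inflection_point (frakH \<alpha>) (1/d)" by (rule infl)
  have "changes_sign_at (\<lambda>s. (1/s - c) * (1/s - d)) (1/c)"
    unfolding changes_sign_at_def
  proof (intro exI[of _ e] conjI disjI1 ballI)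
    fix y assume y: "y \<in> {1/c - e<..<1/c}"
    then have "1/y < d" "1/y > c" using e inv c(1,2) lt[of d y] gt[of y c] by auto
    with c(2) show "(1/y - c) * (1/y - d) < 0" by (simp add: mult_pos_neg)
  next
    fix y assume y: "y \<in> {1/c<..<1/c + e}"
    then have "1/y < c" using lt[of c y] c(1) by auto
    with c(2) show "(1/y - c) * (1/y - d) > 0" by (simp add: mult_neg_neg)
  qed (use e in simp)
  then have i2: "inflection_point (frakH \<alpha>) (1/c)" by (rule infl[rotated]) (use c(1) in simp)
  have "{t \<in> {0<..}. inflection_point (frakH \<alpha>) t} = {1/c, 1/d}"
  proof (intro equalityI subsetI)
    fix t assume t: "t \<in> {t \<in> {0<..}. inflection_point (frakH \<alpha>) t}"
    then have "sgn ((1/t - c) * (1/t - d)) = 0"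
      using inflection_point_frakH_imp_zero[of t \<alpha>] c(3)[of "1/t"] by simp
    then show "t \<in> {1/c, 1/d}" using t by (auto simp: sgn_zero_iff)
  next
    fix t assume "t \<in> {1/c, 1/d}"
    with i1 i2 c(1) inv(2) show "t \<in> {t \<in> {0<..}. inflection_point (frakH \<alpha>) t}" by auto
  qed
  then show ?thesis using c(2) by simp
qed

section \<open>Convexity, limits and the theorem\<close>

lemma frakH_convex:
  assumes "\<alpha> \<ge> 1"
  shows "convex_on {0<..} (frakH \<alpha>)"
proof (rule f''_ge0_imp_convex)
  show "t powr (\<alpha> - 3) * frakH_num \<alpha> (1/t) / (exp (1/t) - 1) ^ 3 \<ge> 0" if "t \<in> {0<..}" for t
    using that frakH_num_nonneg[OF assms, of "1/t"] by simp
qed (use frakH_deriv frakH_deriv2 in auto)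

text \<open>The decay of \<open>exp (- 1 / t)\<close> beats every power of \<open>t\<close>.\<close>

lemma frakH_tendsto_at_right_0: "(frakH \<alpha> \<longlongrightarrow> 0) (at_right 0)"
  unfolding frakH_def by real_asymp

text \<open>Since \<open>exp (1 / t) - 1\<close> is asymptotic to \<open>1 / t\<close>, the function
  behaves like \<open>t powr \<alpha>\<close>.\<close>

lemma frakH_at_top:
  shows "\<alpha> > 0 \<Longrightarrow> filterlim (frakH \<alpha>) at_top at_top"
    and "\<alpha> = 0 \<Longrightarrow> (frakH \<alpha> \<longlongrightarrow> 1) at_top"
    and "\<alpha> < 0 \<Longrightarrow> (frakH \<alpha> \<longlongrightarrow> 0) at_top"
  unfolding frakH_def by real_asymp+

theorem theorem3p1:
  fixes \<alpha> :: real
  shows "(\<alpha> \<ge> 1 \<longrightarrow> convex_on {0<..} (frakH \<alpha>))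
    \<and> (0 \<le> \<alpha> \<and> \<alpha> < 1 \<longrightarrow> (\<exists>!t. t \<in> {0<..} \<and> inflection_point (frakH \<alpha>) t))
    \<and> (\<alpha> < 0 \<longrightarrow> card {t \<in> {0<..}. inflection_point (frakH \<alpha>) t} = 2)
    \<and> (frakH \<alpha> \<longlongrightarrow> 0) (at_right 0)
    \<and> (\<alpha> > 0 \<longrightarrow> filterlim (frakH \<alpha>) at_top at_top)
    \<and> (\<alpha> = 0 \<longrightarrow> (frakH \<alpha> \<longlongrightarrow> 1) at_top)
    \<and> (\<alpha> < 0 \<longrightarrow> (frakH \<alpha> \<longlongrightarrow> 0) at_top)"
  using frakH_convex[of \<alpha>] frakH_unique_inflection_point[of \<alpha>] frakH_two_inflection_points[of \<alpha>]
    frakH_tendsto_at_right_0[of \<alpha>] frakH_at_top[of \<alpha>] by blast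

end
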